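(* Let $\mathbf{x}:U\to\mathbb{R}^3$ be a proper wavefront, $\Omega$ a tangent moving basis of $\mathbf{x}$, $\mathbf{p}\in\Sigma(\mathbf{x})$ with $\mathrm{rank}(D\mathbf{x}(\mathbf{p}))=0$, and let $V\subset U$ be an open neighborhood of $\mathbf{p}$ on which $K_\Omega\neq0$. The following statements are equivalent: (1) The mean curvature $H$ has a $C^\infty$-extension to $V$. (2) $H_\Omega\in\mathfrak{T}_\Omega(V)$. (3) $eG+gE-2fF\in\mathfrak{T}^2_\Omega(V)$. (4) $\frac1{k_1}+\frac1{k_2}\in\mathfrak{T}_\Omega(V)$ (where $\frac1{k_1}+\frac1{k_2}$ denotes the $C^\infty$ extension to $V$ of this function). (5) $\frac1{k_{1\Omega}}+\frac1{k_{2\Omega}}$ has a $C^\infty$-extension to $V$.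
   Context: All maps are $C^\infty$; $U\subset\mathbb{R}^2$ is open, with coordinates $(u,v)$. A smooth map $\mathbf{x}:U\to\mathbb{R}^3$ is a frontal if every $\mathbf{p}\in U$ has an open neighborhood $V_p\subset U$ with a smooth unit vector field $\mathbf{n}_p:V_p\to\mathbb{R}^3$ orthogonal to $\mathbf{x}_u,\mathbf{x}_v$; it is a wavefront (front) if moreover each $(\mathbf{x},\mathbf{n}_p)$ is an immersion into $\mathbb{R}^3\times S^2$. The singular set is $\Sigma(\mathbf{x})=\{\mathbf{p}\in U:\mathbf{x}\text{ is not immersive at }\mathbf{p}\}$; $\mathbf{x}$ is proper if $\Sigma(\mathbf{x})$ has empty interior. A tangent moving basis (tmb) of $\mathbf{x}$ is a smooth map $\Omega=(\mathbf{w}_1\ \mathbf{w}_2):U\to\mathcal{M}_{3\times2}(\mathbb{R})$ with linearly independent columns at each point and $\mathbf{x}_u,\mathbf{x}_v\in\mathrm{span}(\mathbf{w}_1,\mathbf{w}_2)$. Put $\mathbf{n}=\frac{\mathbf{w}_1\times\mathbf{w}_2}{\|\mathbf{w}_1\times\mathbf{w}_2\|}$, $\mathbf{I}_\Omega=\Omega^T\Omega$, $\mathbf{II}_\Omega=-\Omega^TD\mathbf{n}$, $\mu_\Omega=-\mathbf{II}_\Omega^T\mathbf{I}_\Omega^{-1}$, $\Lambda_\Omega=D\mathbf{x}^T\Omega\,\mathbf{I}_\Omega^{-1}$, $\lambda_\Omega=\det\Lambda_\Omega$, $K_\Omega=\det\mu_\Omega$, $H_\Omega=-\frac12\mathrm{tr}(\mu_\Omega\,\mathrm{adj}(\Lambda_\Omega))$.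 One has $D\mathbf{x}=\Omega\Lambda_\Omega^T$ and $D\mathbf{n}=\Omega\mu_\Omega^T$, so $\Sigma(\mathbf{x})=\lambda_\Omega^{-1}(0)$. $\mathfrak{T}_\Omega(V)$ is the principal ideal generated by $\lambda_\Omega$ in $C^\infty(V,\mathbb{R})$ and $\mathfrak{T}^2_\Omega(V)$ is its square, i.e. the ideal generated by $\lambda_\Omega^2$. The fundamental forms are $\begin{pmatrix} E & F \\ F & G \end{pmatrix}=D\mathbf{x}^TD\mathbf{x}$ and $\begin{pmatrix} e & f \\ f & g \end{pmatrix}=-D\mathbf{x}^TD\mathbf{n}$ on $U$; on $U\setminus\Sigma(\mathbf{x})$, $K=\frac{eg-f^2}{EG-F^2}$ and $H=\frac{eG+gE-2fF}{2(EG-F^2)}$ are the Gaussian and mean curvatures. The relative principal curvatures are $k_{1\Omega}=H_\Omega-\sqrt{H_\Omega^2-\lambda_\Omega K_\Omega}$ and $k_{2\Omega}=H_\Omega+\sqrt{H_\Omega^2-\lambda_\Omega K_\Omega}$ on $U$. On $U\setminus\Sigma(\mathbf{x})$: $k_1=H-\sqrt{H^2-K}$ and $k_2=H+\sqrt{H^2-K}$ where $\lambda_\Omega>0$; $k_1=H+\sqrt{H^2-K}$ and $k_2=H-\sqrt{H^2-K}$ where $\lambda_\Omega<0$. Where $K_\Omega\ne0$, the functions $k_1,k_2,k_{1\Omega},k_{2\Omega}$ are nonzero off $\Sigma(\mathbf{x})$ and $\frac1{k_1}+\frac1{k_2}$ extends smoothly across $\Sigma(\mathbf{x})$. A $C^\infty$-extension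 to $V$ of a function defined on $V\setminus\Sigma(\mathbf{x})$ is a function in $C^\infty(V,\mathbb{R})$ agreeing with it on $V\setminus\Sigma(\mathbf{x})$. *)

theory Defs
  imports "HOL-Analysis.Analysis"
begin

section \<open>Smooth maps on open sets\<close>

text \<open>For \<open>S\<close> open in a Euclidean space, \<open>Ck_on k S f\<close> is the usual \<open>C^k\<close> condition: all iterated
  directional derivatives of order at most \<open>k\<close> exist and are continuous.
  Both notions below are only meant to be used with \<open>S\<close> open; then they depend only on the
  values of \<open>f\<close> on \<open>S\<close>, so a total function stands for its restriction to \<open>S\<close>.\<close>

primrec Ck_on :: "nat \<Rightarrow> 'a::euclidean_space set \<Rightarrow> ('a \<Rightarrow> 'b::real_normed_vector) \<Rightarrow> bool" where
  "Ck_on 0 S f \<longleftrightarrow> continuous_on S f"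
| "Ck_on (Suc k) S f \<longleftrightarrow>
     (\<forall>x\<in>S. f differentiable (at x)) \<and>
     (\<forall>v. Ck_on k S (\<lambda>x. frechet_derivative f (at x) v))"

definition smooth_on :: "'a::euclidean_space set \<Rightarrow> ('a \<Rightarrow> 'b::real_normed_vector) \<Rightarrow> bool" where
  "smooth_on S f \<longleftrightarrow> (\<forall>k. Ck_on k S f)"

text \<open>\<open>g\<close> is a \<open>C^\<infinity>\<close>-extension to \<open>V\<close> of the restriction of \<open>f\<close> to \<open>V - S\<close>; the values
  of \<open>f\<close> on \<open>S\<close> are irrelevant.\<close>

definition is_smooth_extension ::
    "'a::euclidean_space set \<Rightarrow> 'a set \<Rightarrow> ('a \<Rightarrow> real) \<Rightarrow> ('a \<Rightarrow> real) \<Rightarrow> bool" where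
  "is_smooth_extension V S f g \<longleftrightarrow> smooth_on V g \<and> (\<forall>q\<in>V - S. g q = f q)"

definition has_smooth_extension ::
    "'a::euclidean_space set \<Rightarrow> 'a set \<Rightarrow> ('a \<Rightarrow> real) \<Rightarrow> bool" where
  "has_smooth_extension V S f \<longleftrightarrow> (\<exists>g. is_smooth_extension V S f g)"

text \<open>The principal ideal of the ring \<open>C^\<infinity>(V, \<real>)\<close> generated by \<open>l\<close>; elements of the ring
  are represented by total functions and compared on \<open>V\<close> only.\<close>

definition smooth_principal_ideal ::
    "'a::euclidean_space set \<Rightarrow> ('a \<Rightarrow> real) \<Rightarrow> ('a \<Rightarrow> real) set" where
  "smooth_principal_ideal V l =
     {f. smooth_on V f \<and> (\<exists>h. smooth_on V h \<and> (\<forall>q\<in>V. f q = h q * l q))}"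

section \<open>Wavefronts\<close>

definition immersive_at :: "('a::euclidean_space \<Rightarrow> 'b::real_normed_vector) \<Rightarrow> 'a \<Rightarrow> bool" where
  "immersive_at f p \<longleftrightarrow> inj (frechet_derivative f (at p))"

definition singular_set :: "(real^2) set \<Rightarrow> (real^2 \<Rightarrow> real^3) \<Rightarrow> (real^2) set" where
  "singular_set U x = {p \<in> U. \<not> immersive_at x p}"

definition proper_on :: "(real^2) set \<Rightarrow> (real^2 \<Rightarrow> real^3) \<Rightarrow> bool" where
  "proper_on U x \<longleftrightarrow> interior (singular_set U x) = {}"

text \<open>The columns of \<open>jacobian x (at q)\<close> are the partial derivatives \<open>x_u\<close> and \<open>x_v\<close> at \<open>q\<close>.\<close>

definition unit_normal_field ::
    "(real^2 \<Rightarrow> real^3) \<Rightarrow> (real^2) set \<Rightarrow> (real^2 \<Rightarrow> real^3) \<Rightarrow> bool" where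
  "unit_normal_field x V n \<longleftrightarrow> smooth_on V n \<and>
     (\<forall>q\<in>V. norm (n q) = 1 \<and> (\<forall>j. n q \<bullet> column j (jacobian x (at q)) = 0))"

text \<open>Since \<open>S\<^sup>2\<close> is a submanifold of \<open>\<real>\<^sup>3\<close>, \<open>(x, n)\<close> is an immersion into \<open>\<real>\<^sup>3 \<times> S\<^sup>2\<close> iff it is
  one into \<open>\<real>\<^sup>3 \<times> \<real>\<^sup>3\<close>. Dropping the last conjunct gives the notion of a frontal.\<close>

definition wavefront :: "(real^2) set \<Rightarrow> (real^2 \<Rightarrow> real^3) \<Rightarrow> bool" where
  "wavefront U x \<longleftrightarrow> smooth_on U x \<and>
     (\<forall>p\<in>U. \<exists>V n. open V \<and> p \<in> V \<and> V \<subseteq> U \<and> unit_normal_field x V n \<and>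
        (\<forall>q\<in>V. immersive_at (\<lambda>r. (x r, n r)) q))"

section \<open>Tangent moving bases and the associated functions\<close>

text \<open>\<open>inj\<close> rules out two equal columns, which the set-based \<open>independent\<close> does not see.\<close>

definition tangent_moving_basis ::
    "(real^2) set \<Rightarrow> (real^2 \<Rightarrow> real^3) \<Rightarrow> (real^2 \<Rightarrow> real^2^3) \<Rightarrow> bool" where
  "tangent_moving_basis U x \<Omega> \<longleftrightarrow> smooth_on U \<Omega> \<and>
     (\<forall>q\<in>U. inj (\<lambda>j. column j (\<Omega> q)) \<and> independent (columns (\<Omega> q)) \<and>
            columns (jacobian x (at q)) \<subseteq> span (columns (\<Omega> q)))"

definition tmb_normal :: "(real^2 \<Rightarrow> real^2^3) \<Rightarrow> real^2 \<Rightarrow> real^3" where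
  "tmb_normal \<Omega> q =
     (let c = cross3 (column 1 (\<Omega> q)) (column 2 (\<Omega> q)) in (1 / norm c) *\<^sub>R c)"

definition tmb_I :: "(real^2 \<Rightarrow> real^2^3) \<Rightarrow> real^2 \<Rightarrow> real^2^2" where
  "tmb_I \<Omega> q = transpose (\<Omega> q) ** \<Omega> q"

definition tmb_II :: "(real^2 \<Rightarrow> real^2^3) \<Rightarrow> real^2 \<Rightarrow> real^2^2" where
  "tmb_II \<Omega> q = - (transpose (\<Omega> q) ** jacobian (tmb_normal \<Omega>) (at q))"

definition tmb_mu :: "(real^2 \<Rightarrow> real^2^3) \<Rightarrow> real^2 \<Rightarrow> real^2^2" where
  "tmb_mu \<Omega> q = - (transpose (tmb_II \<Omega> q) ** matrix_inv (tmb_I \<Omega> q))"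

definition tmb_Lambda ::
    "(real^2 \<Rightarrow> real^3) \<Rightarrow> (real^2 \<Rightarrow> real^2^3) \<Rightarrow> real^2 \<Rightarrow> real^2^2" where
  "tmb_Lambda x \<Omega> q = transpose (jacobian x (at q)) ** \<Omega> q ** matrix_inv (tmb_I \<Omega> q)"

definition adj2 :: "real^2^2 \<Rightarrow> real^2^2" where
  "adj2 A = vector [vector [A$2$2, - A$1$2], vector [- A$2$1, A$1$1]]"

definition tmb_lambda ::
    "(real^2 \<Rightarrow> real^3) \<Rightarrow> (real^2 \<Rightarrow> real^2^3) \<Rightarrow> real^2 \<Rightarrow> real" where
  "tmb_lambda x \<Omega> q = det (tmb_Lambda x \<Omega> q)"

definition tmb_K :: "(real^2 \<Rightarrow> real^2^3) \<Rightarrow> real^2 \<Rightarrow> real" where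
  "tmb_K \<Omega> q = det (tmb_mu \<Omega> q)"

definition tmb_H ::
    "(real^2 \<Rightarrow> real^3) \<Rightarrow> (real^2 \<Rightarrow> real^2^3) \<Rightarrow> real^2 \<Rightarrow> real" where
  "tmb_H x \<Omega> q = - (1/2) * trace (tmb_mu \<Omega> q ** adj2 (tmb_Lambda x \<Omega> q))"

definition rel_k1 ::
    "(real^2 \<Rightarrow> real^3) \<Rightarrow> (real^2 \<Rightarrow> real^2^3) \<Rightarrow> real^2 \<Rightarrow> real" where
  "rel_k1 x \<Omega> q = tmb_H x \<Omega> q - sqrt ((tmb_H x \<Omega> q)\<^sup>2 - tmb_lambda x \<Omega> q * tmb_K \<Omega> q)"

definition rel_k2 ::
    "(real^2 \<Rightarrow> real^3) \<Rightarrow> (real^2 \<Rightarrow> real^2^3) \<Rightarrow> real^2 \<Rightarrow> real" where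
  "rel_k2 x \<Omega> q = tmb_H x \<Omega> q + sqrt ((tmb_H x \<Omega> q)\<^sup>2 - tmb_lambda x \<Omega> q * tmb_K \<Omega> q)"

abbreviation tmb_ideal ::
    "(real^2 \<Rightarrow> real^3) \<Rightarrow> (real^2 \<Rightarrow> real^2^3) \<Rightarrow> (real^2) set \<Rightarrow> (real^2 \<Rightarrow> real) set" where
  "tmb_ideal x \<Omega> V \<equiv> smooth_principal_ideal V (tmb_lambda x \<Omega>)"

text \<open>The square of a principal ideal is generated by the square of the generator.\<close>

abbreviation tmb_ideal_sq ::
    "(real^2 \<Rightarrow> real^3) \<Rightarrow> (real^2 \<Rightarrow> real^2^3) \<Rightarrow> (real^2) set \<Rightarrow> (real^2 \<Rightarrow> real) set" where
  "tmb_ideal_sq x \<Omega> V \<equiv> smooth_principal_ideal V (\<lambda>q. (tmb_lambda x \<Omega> q)\<^sup>2)"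

section \<open>Fundamental forms and curvatures\<close>

definition fund_form_1 :: "(real^2 \<Rightarrow> real^3) \<Rightarrow> real^2 \<Rightarrow> real^2^2" where
  "fund_form_1 x q = transpose (jacobian x (at q)) ** jacobian x (at q)"

definition fund_form_2 ::
    "(real^2 \<Rightarrow> real^3) \<Rightarrow> (real^2 \<Rightarrow> real^2^3) \<Rightarrow> real^2 \<Rightarrow> real^2^2" where
  "fund_form_2 x \<Omega> q = - (transpose (jacobian x (at q)) ** jacobian (tmb_normal \<Omega>) (at q))"

definition coeff_E :: "(real^2 \<Rightarrow> real^3) \<Rightarrow> real^2 \<Rightarrow> real" where
  "coeff_E x q = fund_form_1 x q $ 1 $ 1"

definition coeff_F :: "(real^2 \<Rightarrow> real^3) \<Rightarrow> real^2 \<Rightarrow> real" where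
  "coeff_F x q = fund_form_1 x q $ 1 $ 2"

definition coeff_G :: "(real^2 \<Rightarrow> real^3) \<Rightarrow> real^2 \<Rightarrow> real" where
  "coeff_G x q = fund_form_1 x q $ 2 $ 2"

definition coeff_e ::
    "(real^2 \<Rightarrow> real^3) \<Rightarrow> (real^2 \<Rightarrow> real^2^3) \<Rightarrow> real^2 \<Rightarrow> real" where
  "coeff_e x \<Omega> q = fund_form_2 x \<Omega> q $ 1 $ 1"

text \<open>\<open>fund_form_2\<close> is symmetric at every point of \<open>U\<close> (differentiate \<open>x_u \<bullet> n = x_v \<bullet> n = 0\<close>), so
  either off-diagonal entry may serve as \<open>f\<close>.\<close>

definition coeff_f ::
    "(real^2 \<Rightarrow> real^3) \<Rightarrow> (real^2 \<Rightarrow> real^2^3) \<Rightarrow> real^2 \<Rightarrow> real" where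
  "coeff_f x \<Omega> q = fund_form_2 x \<Omega> q $ 1 $ 2"

definition coeff_g ::
    "(real^2 \<Rightarrow> real^3) \<Rightarrow> (real^2 \<Rightarrow> real^2^3) \<Rightarrow> real^2 \<Rightarrow> real" where
  "coeff_g x \<Omega> q = fund_form_2 x \<Omega> q $ 2 $ 2"

text \<open>The functions below are meaningful off the singular set only; on it, where
  \<open>E G - F\<^sup>2 = 0\<close>, their values are artefacts of division by zero.\<close>

definition gauss_curv ::
    "(real^2 \<Rightarrow> real^3) \<Rightarrow> (real^2 \<Rightarrow> real^2^3) \<Rightarrow> real^2 \<Rightarrow> real" where
  "gauss_curv x \<Omega> q =
     (coeff_e x \<Omega> q * coeff_g x \<Omega> q - (coeff_f x \<Omega> q)\<^sup>2) /
     (coeff_E x q * coeff_G x q - (coeff_F x q)\<^sup>2)"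

definition mean_curv ::
    "(real^2 \<Rightarrow> real^3) \<Rightarrow> (real^2 \<Rightarrow> real^2^3) \<Rightarrow> real^2 \<Rightarrow> real" where
  "mean_curv x \<Omega> q =
     (coeff_e x \<Omega> q * coeff_G x q + coeff_g x \<Omega> q * coeff_E x q
        - 2 * coeff_f x \<Omega> q * coeff_F x q) /
     (2 * (coeff_E x q * coeff_G x q - (coeff_F x q)\<^sup>2))"

definition princ_k1 ::
    "(real^2 \<Rightarrow> real^3) \<Rightarrow> (real^2 \<Rightarrow> real^2^3) \<Rightarrow> real^2 \<Rightarrow> real" where
  "princ_k1 x \<Omega> q =
     (if tmb_lambda x \<Omega> q > 0
      then mean_curv x \<Omega> q - sqrt ((mean_curv x \<Omega> q)\<^sup>2 - gauss_curv x \<Omega> q)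
      else mean_curv x \<Omega> q + sqrt ((mean_curv x \<Omega> q)\<^sup>2 - gauss_curv x \<Omega> q))"

definition princ_k2 ::
    "(real^2 \<Rightarrow> real^3) \<Rightarrow> (real^2 \<Rightarrow> real^2^3) \<Rightarrow> real^2 \<Rightarrow> real" where
  "princ_k2 x \<Omega> q =
     (if tmb_lambda x \<Omega> q > 0
      then mean_curv x \<Omega> q + sqrt ((mean_curv x \<Omega> q)\<^sup>2 - gauss_curv x \<Omega> q)
      else mean_curv x \<Omega> q - sqrt ((mean_curv x \<Omega> q)\<^sup>2 - gauss_curv x \<Omega> q))"

end

theory Submission
  imports Defs
begin

text \<open>Write \<open>d = det I\<^sub>\<Omega> > 0\<close>. From \<open>Dx = \<Omega> \<Lambda>\<^sup>T\<close> and \<open>Dn = \<Omega> \<mu>\<^sup>T\<close> one gets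
  \<open>E G - F\<^sup>2 = \<lambda>\<^sup>2 d\<close>, \<open>e g - f\<^sup>2 = \<lambda> K\<^sub>\<Omega> d\<close> and \<open>e G + g E - 2 f F = 2 \<lambda> d H\<^sub>\<Omega>\<close>, the last two
  by the symmetry of the second fundamental form. Hence, off the singular set, \<open>H = H\<^sub>\<Omega> / \<lambda>\<close>,
  \<open>K = K\<^sub>\<Omega> / \<lambda>\<close>, \<open>1/k\<^sub>1 + 1/k\<^sub>2 = 2 H\<^sub>\<Omega> / K\<^sub>\<Omega>\<close> and
  \<open>1/k\<^sub>1\<^sub>\<Omega> + 1/k\<^sub>2\<^sub>\<Omega> = 2 H\<^sub>\<Omega> / (\<lambda> K\<^sub>\<Omega>)\<close>. As \<open>d\<close> and \<open>K\<^sub>\<Omega>\<close> are units on \<open>V\<close>, each of the five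
  statements says that \<open>H\<^sub>\<Omega> = h \<lambda>\<close> off the singular set for some smooth \<open>h\<close>, and this
  extends to \<open>V\<close> because the complement of the singular set is dense.\<close>

section \<open>Calculus of smooth maps\<close>

text \<open>\<open>S\<close> is open, so a derivative at a point of \<open>S\<close> sees only the
  values of the map on \<open>S\<close>; the induction carries this to all orders. It lets one total
  formula be replaced by a more convenient one.\<close>

lemma Ck_on_cong:
  assumes "open S" "\<And>x. x \<in> S \<Longrightarrow> f x = g x" "Ck_on k S f"
  shows "Ck_on k S g"
  using assms(2,3)
proof (induction k arbitrary: f g)
  case 0
  then show ?case by (auto cong: continuous_on_cong)
next
  case (Suc k)
  have deriv: "(f has_derivative frechet_derivative f (at x)) (at x)" if "x \<in> S" for x
    using Suc.prems(2) that by (simp add: frechet_derivative_works[symmetric])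
  have g: "(g has_derivative frechet_derivative f (at x)) (at x)" if "x \<in> S" for x
    by (rule has_derivative_transform_within_open[OF deriv \<open>open S\<close>]) (use that Suc.prems in auto)
  have "frechet_derivative f (at x) = frechet_derivative g (at x)" if "x \<in> S" for x
    using frechet_derivative_at[OF g[OF that]] .
  then have "Ck_on k S (\<lambda>x. frechet_derivative g (at x) v)" for v
    using Suc.prems(2) by (intro Suc.IH[of "\<lambda>x. frechet_derivative f (at x) v" "\<lambda>x. frechet_derivative g (at x) v"]) auto
  moreover have "g differentiable (at x)" if "x \<in> S" for x
    using g[OF that] by (rule differentiableI)
  ultimately show ?case by simp
qed

text \<open>Derivatives are unique, so any explicit family \<open>f'\<close> may stand in for
  \<open>frechet_derivative\<close>; the inductions below feed in the rules of calculus through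
  \<open>f'\<close>.\<close>

lemma Ck_on_Suc_intro:
  assumes "\<And>x. x \<in> S \<Longrightarrow> (f has_derivative f' x) (at x)"
    and "\<And>v. Ck_on k S (\<lambda>x. f' x v)" and "open S"
  shows "Ck_on (Suc k) S f"
proof -
  have "f' x = frechet_derivative f (at x)" if "x \<in> S" for x
    using frechet_derivative_at[OF assms(1)[OF that]] .
  then have "Ck_on k S (\<lambda>x. frechet_derivative f (at x) v)" for v
    using assms(2) by (intro Ck_on_cong[of S "\<lambda>x. f' x v" "\<lambda>x. frechet_derivative f (at x) v"] assms(3)) auto
  then show ?thesis
    using assms(1) by (auto simp: differentiable_def)
qed

lemma Ck_on_Suc_has_derivative:
  "Ck_on (Suc k) S f \<Longrightarrow> x \<in> S \<Longrightarrow> (f has_derivative frechet_derivative f (at x)) (at x)"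
  by (simp add: frechet_derivative_works[symmetric])

lemma Ck_on_Suc_imp_Ck_on: "Ck_on (Suc k) S f \<Longrightarrow> Ck_on k S f"
proof (induction k arbitrary: f)
  case 0
  then show ?case
    by (auto intro!: continuous_at_imp_continuous_on differentiable_imp_continuous_within)
next
  case (Suc k)
  then show ?case by (metis Ck_on.simps(2))
qed

lemma Ck_on_const: "open S \<Longrightarrow> Ck_on k S (\<lambda>x. c)"
proof (induction k arbitrary: c)
  case (Suc k)
  show ?case
    by (rule Ck_on_Suc_intro[where f' = "\<lambda>_ _. 0"]) (use Suc in auto)
qed auto

lemma Ck_on_add:
  assumes "open S" "Ck_on k S f" "Ck_on k S g"
  shows "Ck_on k S (\<lambda>x. f x + g x)"
  using assms(2,3)
proof (induction k arbitrary: f g)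
  case (Suc k)
  show ?case
    by (rule Ck_on_Suc_intro) (use Suc assms(1) in
      \<open>auto intro!: derivative_eq_intros Ck_on_Suc_has_derivative[OF Suc.prems(1)]
        Ck_on_Suc_has_derivative[OF Suc.prems(2)]\<close>)
qed (simp add: continuous_on_add)

lemma (in bounded_linear) Ck_on_compose:
  assumes "open S" "Ck_on k S g"
  shows "Ck_on k S (\<lambda>x. f (g x))"
  using assms(2)
proof (induction k arbitrary: g)
  case 0
  then show ?case by (auto intro: continuous_on)
next
  case (Suc k)
  show ?case
    by (rule Ck_on_Suc_intro[OF has_derivative[OF Ck_on_Suc_has_derivative[OF Suc.prems]]])
      (use Suc assms(1) in auto)
qed

text \<open>The product rule gives a sum of two products of the same kind, each with one factor
  differentiated and the other lowered to order \<open>k\<close>, so the induction runs over both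
  factors at once. Scalar, inner, cross and matrix products are all instances.\<close>

lemma (in bounded_bilinear) Ck_on_compose:
  assumes "open S" "Ck_on k S f" "Ck_on k S g"
  shows "Ck_on k S (\<lambda>x. prod (f x) (g x))"
  using assms(2,3)
proof (induction k arbitrary: f g)
  case 0
  then show ?case by (auto intro: continuous_on)
next
  case (Suc k)
  show ?case
  proof (rule Ck_on_Suc_intro[OF FDERIV[OF Ck_on_Suc_has_derivative[OF Suc.prems(1)]
          Ck_on_Suc_has_derivative[OF Suc.prems(2)]] _ \<open>open S\<close>])
    show "Ck_on k S (\<lambda>x. prod (f x) (frechet_derivative g (at x) v)
        + prod (frechet_derivative f (at x) v) (g x))" for v
      using Suc.prems Ck_on_Suc_imp_Ck_on[OF Suc.prems(1)] Ck_on_Suc_imp_Ck_on[OF Suc.prems(2)]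
      by (intro Ck_on_add Suc.IH \<open>open S\<close>) auto
  qed
qed

section \<open>Smooth maps and their closure under algebraic operations\<close>

lemma smooth_on_cong:
  "open S \<Longrightarrow> (\<And>x. x \<in> S \<Longrightarrow> f x = g x) \<Longrightarrow> smooth_on S f \<Longrightarrow> smooth_on S g"
  unfolding smooth_on_def using Ck_on_cong[of S f g] by blast

lemma smooth_on_subset: "smooth_on S f \<Longrightarrow> T \<subseteq> S \<Longrightarrow> smooth_on T f"
proof -
  have "T \<subseteq> S \<Longrightarrow> Ck_on k S f \<Longrightarrow> Ck_on k T f" for k
    by (induction k arbitrary: f) (auto intro: continuous_on_subset)
  then show "smooth_on S f \<Longrightarrow> T \<subseteq> S \<Longrightarrow> smooth_on T f"
    by (simp add: smooth_on_def)
qed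

lemma smooth_on_continuous_on: "smooth_on S f \<Longrightarrow> continuous_on S f"
  unfolding smooth_on_def by (drule spec[of _ 0]) simp

lemma smooth_on_has_derivative:
  "smooth_on S f \<Longrightarrow> x \<in> S \<Longrightarrow> (f has_derivative frechet_derivative f (at x)) (at x)"
  unfolding smooth_on_def by (rule Ck_on_Suc_has_derivative) (erule spec)

lemma smooth_on_frechet_derivative:
  "smooth_on S f \<Longrightarrow> smooth_on S (\<lambda>x. frechet_derivative f (at x) v)"
  unfolding smooth_on_def using Ck_on.simps(2)[of _ S f] by blast

lemma smooth_on_const: "open S \<Longrightarrow> smooth_on S (\<lambda>x. c)"
  by (simp add: smooth_on_def Ck_on_const)

lemma smooth_on_add:
  "open S \<Longrightarrow> smooth_on S f \<Longrightarrow> smooth_on S g \<Longrightarrow> smooth_on S (\<lambda>x. f x + g x)"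
  by (simp add: smooth_on_def Ck_on_add)

lemma (in bounded_linear) smooth_on_compose:
  "open S \<Longrightarrow> smooth_on S g \<Longrightarrow> smooth_on S (\<lambda>x. f (g x))"
  by (simp add: smooth_on_def Ck_on_compose)

lemma (in bounded_bilinear) smooth_on_compose:
  "open S \<Longrightarrow> smooth_on S f \<Longrightarrow> smooth_on S g \<Longrightarrow> smooth_on S (\<lambda>x. prod (f x) (g x))"
  by (simp add: smooth_on_def Ck_on_compose)

lemmas smooth_on_mult = bounded_bilinear.smooth_on_compose[OF bounded_bilinear_mult]
lemmas smooth_on_scaleR = bounded_bilinear.smooth_on_compose[OF bounded_bilinear_scaleR]
lemmas smooth_on_inner = bounded_bilinear.smooth_on_compose[OF bounded_bilinear_inner]
lemmas smooth_on_minus = bounded_linear.smooth_on_compose[OF bounded_linear_minus[OF bounded_linear_ident]]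
lemmas smooth_on_nth = bounded_linear.smooth_on_compose[OF bounded_linear_vec_nth]

lemma smooth_on_diff:
  "open S \<Longrightarrow> smooth_on S f \<Longrightarrow> smooth_on S g \<Longrightarrow> smooth_on S (\<lambda>x. f x - g x)"
  using smooth_on_add[of S f "\<lambda>x. - g x"] by (simp add: smooth_on_minus)

lemma smooth_on_sum:
  "open S \<Longrightarrow> (\<And>i. i \<in> I \<Longrightarrow> smooth_on S (f i)) \<Longrightarrow> smooth_on S (\<lambda>x. \<Sum>i\<in>I. f i x)"
  by (induction I rule: infinite_finite_induct) (auto intro: smooth_on_const smooth_on_add)

text \<open>The derivative of \<open>1/f\<close> is built from \<open>1/f\<close> itself and the
  derivative of \<open>f\<close>, so each order of differentiability of \<open>1/f\<close> yields
  the next.\<close>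

lemma smooth_on_inverse:
  fixes f :: "'a::euclidean_space \<Rightarrow> real"
  assumes "open S" "smooth_on S f" and nz: "\<And>x. x \<in> S \<Longrightarrow> f x \<noteq> 0"
  shows "smooth_on S (\<lambda>x. inverse (f x))"
proof -
  have "Ck_on k S (\<lambda>x. inverse (f x))" for k
  proof (induction k)
    case 0
    then show ?case
      using nz smooth_on_continuous_on[OF assms(2)] by (simp add: continuous_on_inverse)
  next
    case (Suc k)
    have D: "Ck_on k S (\<lambda>x. frechet_derivative f (at x) v)" for v
      using smooth_on_frechet_derivative[OF assms(2)] by (simp add: smooth_on_def)
    note mult = bounded_bilinear.Ck_on_compose[OF bounded_bilinear_mult \<open>open S\<close>]
    note minus = bounded_linear.Ck_on_compose[OF bounded_linear_minus[OF bounded_linear_ident] \<open>open S\<close>]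
    show ?case
      by (rule Ck_on_Suc_intro[OF Deriv.has_derivative_inverse[OF nz smooth_on_has_derivative[OF assms(2)]]])
        (auto intro!: minus mult D Suc assms(1))
  qed
  then show ?thesis by (simp add: smooth_on_def)
qed

lemma smooth_on_divide:
  fixes f g :: "'a::euclidean_space \<Rightarrow> real"
  shows "open S \<Longrightarrow> smooth_on S f \<Longrightarrow> smooth_on S g \<Longrightarrow> (\<And>x. x \<in> S \<Longrightarrow> g x \<noteq> 0)
    \<Longrightarrow> smooth_on S (\<lambda>x. f x / g x)"
  unfolding divide_inverse by (rule smooth_on_mult[OF _ _ smooth_on_inverse])

lemma smooth_on_sqrt:
  fixes f :: "'a::euclidean_space \<Rightarrow> real"
  assumes "open S" "smooth_on S f" and pos: "\<And>x. x \<in> S \<Longrightarrow> f x > 0"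
  shows "smooth_on S (\<lambda>x. sqrt (f x))"
proof -
  have "Ck_on k S (\<lambda>x. sqrt (f x))" for k
  proof (induction k)
    case 0
    then show ?case
      using smooth_on_continuous_on[OF assms(2)] by (simp add: continuous_on_real_sqrt)
  next
    case (Suc k)
    \<comment> \<open>Writing the factor as \<open>sqrt f / (2 f)\<close> instead of
      \<open>1 / (2 sqrt f)\<close> makes the square root itself reappear, so that the induction
      hypothesis applies.\<close>
    have deriv: "((\<lambda>x. sqrt (f x)) has_derivative
        (\<lambda>v. frechet_derivative f (at x) v * (inverse (2 * f x) * sqrt (f x)))) (at x)" if "x \<in> S" for x
    proof -
      have "((\<lambda>x. sqrt (f x)) has_derivative
          (\<lambda>v. frechet_derivative f (at x) v * (inverse (sqrt (f x)) / 2))) (at x)"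
        by (rule DERIV_real_sqrt[THEN DERIV_compose_FDERIV, OF pos[OF that]
              smooth_on_has_derivative[OF assms(2) that]])
      moreover have "inverse (sqrt (f x)) / 2 = inverse (2 * f x) * sqrt (f x)"
        using pos[OF that] by (simp add: real_inv_sqrt_pow2 field_simps flip: power2_eq_square)
      ultimately show ?thesis by simp
    qed
    have "smooth_on S (\<lambda>x. inverse (2 * f x))"
      using pos by (intro smooth_on_inverse smooth_on_mult smooth_on_const assms(1,2)) force
    then have "Ck_on k S (\<lambda>x. inverse (2 * f x))" "Ck_on k S (\<lambda>x. frechet_derivative f (at x) v)" for v
      using smooth_on_frechet_derivative[OF assms(2)] by (simp_all add: smooth_on_def)
    then show ?case
      by (intro Ck_on_Suc_intro[OF deriv] bounded_bilinear.Ck_on_compose[OF bounded_bilinear_mult] Suc assms(1))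
  qed
  then show ?thesis by (simp add: smooth_on_def)
qed

text \<open>A vector is the sum of its components embedded by the linear maps \<open>axis i\<close>.
  Components may be vectors themselves, so two applications treat a matrix.\<close>

lemma smooth_on_vec:
  fixes f :: "'a::euclidean_space \<Rightarrow> 'b::euclidean_space^'n"
  assumes "open S" "\<And>i. smooth_on S (\<lambda>x. f x $ i)"
  shows "smooth_on S f"
proof -
  have "bounded_linear (axis i :: 'b \<Rightarrow> 'b^'n)" for i
    by (intro linear_linear[THEN iffD2] linearI) (auto simp: vec_eq_iff axis_def)
  then have "smooth_on S (\<lambda>x. \<Sum>i\<in>UNIV. axis i (f x $ i))"
    using assms by (intro smooth_on_sum bounded_linear.smooth_on_compose[of "axis _"])
  moreover have "(\<Sum>i\<in>UNIV. axis i (f x $ i)) = f x" for x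
    by (simp add: vec_eq_iff axis_def if_distrib sum.delta cong: if_cong)
  ultimately show ?thesis by simp
qed

lemma smooth_on_jacobian:
  fixes f :: "real^'m \<Rightarrow> real^'n"
  assumes "open S" "smooth_on S f"
  shows "smooth_on S (\<lambda>x. jacobian f (at x))"
  unfolding jacobian_def matrix_def
  by (rule smooth_on_vec[OF assms(1)], rule smooth_on_vec[OF assms(1)])
    (auto intro!: smooth_on_nth assms smooth_on_frechet_derivative)

section \<open>Smoothness of matrix operations and of the cross product\<close>

lemma bounded_bilinear_matrix_mult:
  "bounded_bilinear ((**) :: real^'n^'m \<Rightarrow> real^'p^'n \<Rightarrow> real^'p^'m)"
  unfolding bilinear_conv_bounded_bilinear[symmetric] bilinear_def
  by (auto intro!: linearI simp: vec_eq_iff matrix_matrix_mult_def algebra_simps sum.distrib sum_distrib_left)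

lemma bounded_linear_transpose: "bounded_linear (transpose :: real^'n^'m \<Rightarrow> real^'m^'n)"
  by (intro linear_linear[THEN iffD2] linearI) (simp_all add: vec_eq_iff transpose_def)

lemma bounded_linear_column: "bounded_linear (column j :: real^'n^'m \<Rightarrow> real^'m)"
  by (intro linear_linear[THEN iffD2] linearI) (simp_all add: vec_eq_iff column_def)

lemma bounded_linear_adj2: "bounded_linear adj2"
  by (intro linear_linear[THEN iffD2] linearI) (simp_all add: vec_eq_iff adj2_def forall_2)

lemma bounded_linear_trace: "bounded_linear (trace :: real^'n^'n \<Rightarrow> real)"
  by (intro linear_linear[THEN iffD2] linearI) (simp_all add: trace_def sum.distrib sum_distrib_left)

lemma bounded_bilinear_cross3: "bounded_bilinear cross3"
  using bilinear_cross by (simp add: bilinear_conv_bounded_bilinear)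

lemmas smooth_on_matrix_mult = bounded_bilinear.smooth_on_compose[OF bounded_bilinear_matrix_mult]
lemmas smooth_on_transpose = bounded_linear.smooth_on_compose[OF bounded_linear_transpose]
lemmas smooth_on_column = bounded_linear.smooth_on_compose[OF bounded_linear_column]
lemmas smooth_on_adj2 = bounded_linear.smooth_on_compose[OF bounded_linear_adj2]
lemmas smooth_on_trace = bounded_linear.smooth_on_compose[OF bounded_linear_trace]
lemmas smooth_on_cross3 = bounded_bilinear.smooth_on_compose[OF bounded_bilinear_cross3]

lemma smooth_on_det_2:
  fixes A :: "'a::euclidean_space \<Rightarrow> real^2^2"
  assumes "open S" "smooth_on S A"
  shows "smooth_on S (\<lambda>q. det (A q))"
  unfolding det_2 by (intro smooth_on_diff smooth_on_mult smooth_on_nth assms)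

lemma adj2_mult:
  "A ** adj2 A = mat (det A)" "adj2 A ** A = mat (det A)"
  by (simp_all add: vec_eq_iff matrix_matrix_mult_def mat_def adj2_def sum_2 forall_2 det_2 algebra_simps)

text \<open>The adjugate formula expresses the inverse rationally in the entries, which is what
  makes inversion smooth.\<close>

lemma matrix_inv_2:
  fixes A :: "real^2^2"
  assumes "det A \<noteq> 0"
  shows "matrix_inv A = (1 / det A) *\<^sub>R adj2 A"
    and "A ** matrix_inv A = mat 1" and "matrix_inv A ** A = mat 1"
proof -
  let ?B = "(1 / det A) *\<^sub>R adj2 A"
  have "(1 / det A) *\<^sub>R mat (det A) = (mat 1 :: real^2^2)"
    using assms by (simp add: vec_eq_iff mat_def)
  then have B: "A ** ?B = mat 1" "?B ** A = mat 1"
    by (simp_all add: matrix_scalar_ac adj2_mult flip: scalar_matrix_assoc)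
  \<comment> \<open>\<open>matrix_inv\<close> is defined by choice, so \<open>?B\<close> first
    serves as a witness that an inverse exists; uniqueness of inverses then identifies the chosen
    one with \<open>?B\<close>.\<close>
  have "A ** matrix_inv A = mat 1 \<and> matrix_inv A ** A = mat 1"
    unfolding matrix_inv_def by (rule someI[of _ ?B]) (simp only: B simp_thms)
  then show inv: "A ** matrix_inv A = mat 1" "matrix_inv A ** A = mat 1"
    by simp_all
  have "matrix_inv A = (?B ** A) ** matrix_inv A"
    by (simp only: B matrix_mul_lid)
  then show "matrix_inv A = ?B"
    by (simp only: inv matrix_mul_rid flip: matrix_mul_assoc)
qed

lemma smooth_on_matrix_inv_2:
  fixes A :: "'a::euclidean_space \<Rightarrow> real^2^2"
  assumes "open S" "smooth_on S A" "\<And>q. q \<in> S \<Longrightarrow> det (A q) \<noteq> 0"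
  shows "smooth_on S (\<lambda>q. matrix_inv (A q))"
proof (rule smooth_on_cong[OF assms(1)])
  show "smooth_on S (\<lambda>q. (1 / det (A q)) *\<^sub>R adj2 (A q))"
    by (intro smooth_on_scaleR smooth_on_divide smooth_on_const smooth_on_det_2 smooth_on_adj2 assms)
qed (simp add: matrix_inv_2 assms(3))

lemma frechet_derivative_eq_jacobian:
  fixes f :: "real^'m \<Rightarrow> real^'n"
  assumes "smooth_on S f" "q \<in> S"
  shows "frechet_derivative f (at q) v = jacobian f (at q) *v v"
  using has_derivative_linear[OF smooth_on_has_derivative[OF assms]]
  by (simp add: jacobian_def matrix_works)

section \<open>Symmetry of second derivatives\<close>

text \<open>The mean value theorem is used twice: in the direction \<open>a\<close> on the increment
  along \<open>h *\<^sub>R b\<close>, then in the direction \<open>b\<close> on the directional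
  derivative along \<open>a\<close>.\<close>

lemma second_difference_mean_value:
  fixes f :: "'a::real_normed_vector \<Rightarrow> real"
  assumes h: "h > 0"
    and inS: "\<And>s t. s \<in> {0..h} \<Longrightarrow> t \<in> {0..h} \<Longrightarrow> p + s *\<^sub>R a + t *\<^sub>R b \<in> S"
    and D: "\<And>x. x \<in> S \<Longrightarrow> (f has_derivative D x) (at x)"
    and D2: "\<And>x. x \<in> S \<Longrightarrow> ((\<lambda>y. D y a) has_derivative D2 x) (at x)"
  obtains s t where "s \<in> {0<..<h}" "t \<in> {0<..<h}"
    "f (p + h *\<^sub>R a + h *\<^sub>R b) - f (p + h *\<^sub>R a) - f (p + h *\<^sub>R b) + f p
      = h\<^sup>2 * D2 (p + s *\<^sub>R a + t *\<^sub>R b) b"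
proof -
  let ?\<phi> = "\<lambda>s. f (p + s *\<^sub>R a + h *\<^sub>R b) - f (p + s *\<^sub>R a)"
  have lin: "g x (r *\<^sub>R v) = r * g x v"
    if "(F has_derivative g x) (at x)" for F and g :: "'a \<Rightarrow> 'a \<Rightarrow> real" and x v r
    using has_derivative_linear[OF that] by (simp add: linear_cmul)
  have d1: "((\<lambda>s. f (p + s *\<^sub>R a + t *\<^sub>R b)) has_real_derivative D (p + s *\<^sub>R a + t *\<^sub>R b) a) (at s)"
    if "s \<in> {0..h}" "t \<in> {0..h}" for s t
  proof -
    note D' = D[OF inS[OF that]]
    have "((\<lambda>s. f (p + s *\<^sub>R a + t *\<^sub>R b)) has_derivative (\<lambda>r. D (p + s *\<^sub>R a + t *\<^sub>R b) (r *\<^sub>R a))) (at s)"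
      by (rule has_derivative_compose[where f = "\<lambda>s. p + s *\<^sub>R a + t *\<^sub>R b", OF _ D']) (auto intro!: derivative_eq_intros)
    then show ?thesis
      by (simp add: has_field_derivative_def lin[of _ D, OF D'] mult_commute_abs)
  qed
  have d2: "((\<lambda>t. D (p + s *\<^sub>R a + t *\<^sub>R b) a) has_real_derivative D2 (p + s *\<^sub>R a + t *\<^sub>R b) b) (at t)"
    if "s \<in> {0..h}" "t \<in> {0..h}" for s t
  proof -
    note D' = D2[OF inS[OF that]]
    have "((\<lambda>t. D (p + s *\<^sub>R a + t *\<^sub>R b) a) has_derivative (\<lambda>r. D2 (p + s *\<^sub>R a + t *\<^sub>R b) (r *\<^sub>R b))) (at t)"
      by (rule has_derivative_compose[where f = "\<lambda>t. p + s *\<^sub>R a + t *\<^sub>R b", OF _ D']) (auto intro!: derivative_eq_intros)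
    then show ?thesis
      by (simp add: has_field_derivative_def lin[of _ D2, OF D'] mult_commute_abs)
  qed
  have "\<exists>s. 0 < s \<and> s < h \<and> ?\<phi> h - ?\<phi> 0
      = (h - 0) * (D (p + s *\<^sub>R a + h *\<^sub>R b) a - D (p + s *\<^sub>R a) a)"
  proof (rule MVT2[OF h])
    fix s assume "0 \<le> s" "s \<le> h"
    then show "(?\<phi> has_real_derivative D (p + s *\<^sub>R a + h *\<^sub>R b) a - D (p + s *\<^sub>R a) a) (at s)"
      using d1[of s h] d1[of s 0] h by (auto intro!: DERIV_diff)
  qed
  then obtain s where s: "0 < s" "s < h" and eq1: "?\<phi> h - ?\<phi> 0
      = h * (D (p + s *\<^sub>R a + h *\<^sub>R b) a - D (p + s *\<^sub>R a) a)"
    by auto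
  have "\<exists>t. 0 < t \<and> t < h \<and> D (p + s *\<^sub>R a + h *\<^sub>R b) a - D (p + s *\<^sub>R a + 0 *\<^sub>R b) a
      = (h - 0) * D2 (p + s *\<^sub>R a + t *\<^sub>R b) b"
    by (rule MVT2[OF h]) (use d2 s in auto)
  then obtain t where t: "0 < t" "t < h"
    and eq2: "D (p + s *\<^sub>R a + h *\<^sub>R b) a - D (p + s *\<^sub>R a) a = h * D2 (p + s *\<^sub>R a + t *\<^sub>R b) b"
    by auto
  show thesis
    by (rule that[of s t]) (use s t eq1 eq2 in \<open>simp_all add: power2_eq_square algebra_simps\<close>)
qed

text \<open>The second difference over a shrinking parallelogram is symmetric in the two sides.\<close>

lemma mixed_derivatives_commute:
  fixes f :: "'a::real_normed_vector \<Rightarrow> real"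
  assumes "open S" "p \<in> S"
    and D: "\<And>x. x \<in> S \<Longrightarrow> (f has_derivative D x) (at x)"
    and Da: "\<And>x. x \<in> S \<Longrightarrow> ((\<lambda>y. D y a) has_derivative Da x) (at x)"
    and Db: "\<And>x. x \<in> S \<Longrightarrow> ((\<lambda>y. D y b) has_derivative Db x) (at x)"
    and cont: "continuous_on S (\<lambda>x. Da x b)" "continuous_on S (\<lambda>x. Db x a)"
  shows "Da p b = Db p a"
proof -
  obtain r where r: "r > 0" "ball p r \<subseteq> S"
    using assms(1,2) open_contains_ball by blast
  \<comment> \<open>With this side length the parallelogram stays within \<open>r / Suc n\<close> of
    \<open>p\<close>, hence inside \<open>S\<close> and shrinking to \<open>p\<close>. The summand 1
    keeps the denominator positive even if \<open>a\<close> and \<open>b\<close> vanish.\<close>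
  define h where "h n = r / (norm a + norm b + 1) / real (Suc n)" for n
  have nab: "norm a + norm b + 1 > 0"
    by (smt (verit) norm_ge_zero)
  then have hpos: "h n > 0" for n
    using r by (simp add: h_def)
  have small: "norm (s *\<^sub>R a + t *\<^sub>R b) < r / real (Suc n)"
    if "s \<in> {0..h n}" "t \<in> {0..h n}" for s t n
  proof -
    have "norm (s *\<^sub>R a + t *\<^sub>R b) \<le> s * norm a + t * norm b"
      using that norm_triangle_ineq[of "s *\<^sub>R a" "t *\<^sub>R b"] by simp
    also have "\<dots> \<le> h n * norm a + h n * norm b"
      using that by (intro add_mono mult_right_mono) auto
    also have "\<dots> < h n * (norm a + norm b + 1)"
      using hpos[of n] by (simp add: algebra_simps)
    also have "\<dots> = r / real (Suc n)"
      using nab by (simp add: h_def)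
    finally show ?thesis .
  qed
  have le: "r / real (Suc n) \<le> r" for n
    using r by (simp add: divide_le_eq)
  have inS: "p + s *\<^sub>R a + t *\<^sub>R b \<in> S" if "s \<in> {0..h n}" "t \<in> {0..h n}" for s t n
  proof -
    have "dist (p + (s *\<^sub>R a + t *\<^sub>R b)) p < r"
      using small[OF that] le[of n] by (simp add: dist_norm norm_minus_commute del: of_nat_Suc)
    then show ?thesis using r(2) by (auto simp: add.assoc dist_commute)
  qed
  \<comment> \<open>The two points come from one and the same second difference, expanded with
    \<open>a\<close> first and with \<open>b\<close> first; cancelling \<open>(h n)\<^sup>2\<close>
    equates the mixed derivatives there.\<close>
  have "\<exists>y z. dist y p < r / real (Suc n) \<and> dist z p < r / real (Suc n) \<and> y \<in> S \<and> z \<in> S \<and> Da y b = Db z a" for n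
  proof -
    obtain s t where st: "s \<in> {0<..<h n}" "t \<in> {0<..<h n}"
      "f (p + h n *\<^sub>R a + h n *\<^sub>R b) - f (p + h n *\<^sub>R a) - f (p + h n *\<^sub>R b) + f p
        = (h n)\<^sup>2 * Da (p + s *\<^sub>R a + t *\<^sub>R b) b"
      by (rule second_difference_mean_value[OF hpos inS D Da])
    obtain s' t' where st': "s' \<in> {0<..<h n}" "t' \<in> {0<..<h n}"
      "f (p + h n *\<^sub>R b + h n *\<^sub>R a) - f (p + h n *\<^sub>R b) - f (p + h n *\<^sub>R a) + f p
        = (h n)\<^sup>2 * Db (p + s' *\<^sub>R b + t' *\<^sub>R a) a"
    proof (rule second_difference_mean_value[OF hpos _ D Db])
      show "p + s *\<^sub>R b + t *\<^sub>R a \<in> S" if "s \<in> {0..h n}" "t \<in> {0..h n}" for s t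
        using inS[OF that(2,1)] by (simp add: ac_simps)
    qed
    have "(h n)\<^sup>2 * Da (p + s *\<^sub>R a + t *\<^sub>R b) b = (h n)\<^sup>2 * Db (p + s' *\<^sub>R b + t' *\<^sub>R a) a"
      using st(3) st'(3) by (simp add: algebra_simps)
    then have "Da (p + s *\<^sub>R a + t *\<^sub>R b) b = Db (p + t' *\<^sub>R a + s' *\<^sub>R b) a"
      using hpos[of n] by (simp add: algebra_simps)
    moreover have "dist (p + s *\<^sub>R a + t *\<^sub>R b) p < r / real (Suc n)"
      "dist (p + t' *\<^sub>R a + s' *\<^sub>R b) p < r / real (Suc n)"
      using small[of s n t] small[of t' n s'] st st' by (simp_all add: dist_norm add.assoc del: of_nat_Suc)
    ultimately show ?thesis
      using inS[of s n t] inS[of t' n s'] st(1,2) st'(1,2) by force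
  qed
  then obtain y z where yz: "\<And>n. dist (y n) p < r / real (Suc n)" "\<And>n. dist (z n) p < r / real (Suc n)"
    "\<And>n. y n \<in> S" "\<And>n. z n \<in> S" "\<And>n. Da (y n) b = Db (z n) a"
    by metis
  have "(\<lambda>n. r / real (Suc n)) \<longlonglongrightarrow> 0"
    by (rule LIMSEQ_Suc[OF lim_const_over_n])
  then have "y \<longlonglongrightarrow> p" "z \<longlonglongrightarrow> p"
    by (rule metric_tendsto_imp_tendsto, use yz(1,2) r(1) in \<open>simp add: less_imp_le del: of_nat_Suc\<close>)+
  then have "(\<lambda>n. Da (y n) b) \<longlonglongrightarrow> Da p b" "(\<lambda>n. Db (z n) a) \<longlonglongrightarrow> Db p a"
    by (auto intro!: continuous_on_tendsto_compose[OF cont(1)] continuous_on_tendsto_compose[OF cont(2)]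
        yz(3,4) assms(2) eventuallyI)
  then show ?thesis
    using yz(5) LIMSEQ_unique by auto
qed

section \<open>Pairs of binary quadratic forms\<close>

text \<open>To be used with \<open>A\<close> as \<Lambda>, \<open>M\<close> as \<mu> and
  \<open>J\<close> as the Gram matrix of the basis. The first two identities are multiplicativity of
  the determinant. The third left side is the trace of \<open>B ** adj2 I\<close>; since
  \<open>adj2\<close> reverses products, \<open>J\<close> and one factor \<open>A\<close> collapse
  to their determinants.\<close>

lemma fundamental_forms_via_basis:
  fixes A M J :: "real^2^2"
  defines "I \<equiv> A ** J ** transpose A" and "B \<equiv> - (A ** J ** transpose M)"
  assumes J: "transpose J = J" and B: "B$1$2 = B$2$1"
  shows "I$1$1 * I$2$2 - (I$1$2)\<^sup>2 = (det A)\<^sup>2 * det J"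
    and "B$1$1 * B$2$2 - (B$1$2)\<^sup>2 = det A * det M * det J"
    and "B$1$1 * I$2$2 + B$2$2 * I$1$1 - 2 * B$1$2 * I$1$2
      = 2 * det A * det J * (- (1/2) * trace (M ** adj2 A))"
proof -
  have J21: "J$2$1 = J$1$2"
    using arg_cong[OF J, of "\<lambda>X. X$1$2"] by (simp add: transpose_def)
  have I: "I$2$1 = I$1$2"
    by (simp add: I_def matrix_matrix_mult_def transpose_def sum_2 J21 algebra_simps)
  have "det I = (det A)\<^sup>2 * det J"
    by (simp add: I_def det_mul det_transpose power2_eq_square)
  with I show "I$1$1 * I$2$2 - (I$1$2)\<^sup>2 = (det A)\<^sup>2 * det J"
    by (simp add: det_2 power2_eq_square)
  have "det (- X) = det X" for X :: "real^2^2"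
    by (simp add: det_2)
  then have "det B = det A * det M * det J"
    by (simp add: B_def det_mul det_transpose)
  with B show "B$1$1 * B$2$2 - (B$1$2)\<^sup>2 = det A * det M * det J"
    by (simp add: det_2 power2_eq_square)
  \<comment> \<open>With the two mixed products kept apart this is an identity in the entries using
    only the symmetry of \<open>J\<close>; the symmetry of \<open>I\<close> and \<open>B\<close>
    merges them afterwards.\<close>
  have "B$1$1 * I$2$2 + B$2$2 * I$1$1 - B$1$2 * I$2$1 - B$2$1 * I$1$2
      = - (det A * det J * trace (M ** adj2 A))"
    by (simp add: I_def B_def matrix_matrix_mult_def transpose_def sum_2 det_2 trace_def adj2_def J21
        algebra_simps)
  with I B show "B$1$1 * I$2$2 + B$2$2 * I$1$1 - 2 * B$1$2 * I$1$2
      = 2 * det A * det J * (- (1/2) * trace (M ** adj2 A))"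
    by (simp add: algebra_simps)
qed

text \<open>The principal curvatures are real: the pencil \<open>II - k I\<close> has a positive definite \<open>I\<close>.\<close>

lemma binary_forms_discriminant:
  fixes E F G e f g :: real
  assumes "E > 0" "E * G - F\<^sup>2 > 0"
  shows "4 * (E * G - F\<^sup>2) * (e * g - f\<^sup>2) \<le> (e * G + g * E - 2 * f * F)\<^sup>2"
proof -
  \<comment> \<open>Multiplied by \<open>E\<^sup>2\<close>, the discriminant becomes a nonnegative
    combination of two squares; \<open>E > 0\<close> then allows dividing back.\<close>
  have "E\<^sup>2 * ((e * G + g * E - 2 * f * F)\<^sup>2 - 4 * (E * G - F\<^sup>2) * (e * g - f\<^sup>2))
    = 4 * (E * G - F\<^sup>2) * (E * f - F * e)\<^sup>2 + (E * (E * g - G * e) - 2 * F * (E * f - F * e))\<^sup>2"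
    by algebra
  also have "\<dots> \<ge> 0" using assms by simp
  finally show ?thesis
    using assms(1) by (simp add: zero_le_mult_iff)
qed

section \<open>Tangent moving bases\<close>

lemma transpose_tmb_I: "transpose (tmb_I \<Omega> q) = tmb_I \<Omega> q"
  by (simp add: tmb_I_def matrix_transpose_mul)

context
  fixes U :: "(real^2) set" and x :: "real^2 \<Rightarrow> real^3" and \<Omega> :: "real^2 \<Rightarrow> real^2^3"
  assumes U: "open U" and x: "smooth_on U x" and tmb: "tangent_moving_basis U x \<Omega>"
begin

section \<open>Linear algebra of the basis: Gram matrix, \<Lambda>, \<mu> and the fundamental
  forms\<close>

lemma tmb_smooth: "smooth_on U \<Omega>"
  using tmb by (simp add: tangent_moving_basis_def)

lemma tmb_cross_nonzero:
  assumes "q \<in> U"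
  shows "cross3 (column 1 (\<Omega> q)) (column 2 (\<Omega> q)) \<noteq> 0"
proof
  let ?w = "\<lambda>j. column j (\<Omega> q)"
  assume "cross3 (?w 1) (?w 2) = 0"
  then have dep: "?w 1 = 0 \<or> ?w 2 = 0 \<or> (\<exists>c. ?w 2 = c *\<^sub>R ?w 1)"
    by (simp add: cross_eq_0 collinear_lemma)
  have inj: "inj ?w" and indep: "independent (columns (\<Omega> q))"
    using tmb assms by (auto simp: tangent_moving_basis_def)
  have cols: "columns (\<Omega> q) = {?w 1, ?w 2}"
    by (auto simp: columns_def) (metis exhaust_2)
  \<comment> \<open>\<open>columns\<close> is a set and would hide a repeated column; once the two
    are known to differ, independence excludes that one is a multiple of the other.\<close>
  have "?w 1 \<noteq> ?w 2"
    using inj by (auto dest: injD)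
  then have "?w 2 \<notin> span {?w 1}"
    using indep by (auto simp: cols insert_commute[of "?w 1"] independent_insert)
  moreover have "?w 1 \<noteq> 0" "?w 2 \<noteq> 0"
    using indep dependent_zero[of "columns (\<Omega> q)"] by (auto simp: cols)
  ultimately show False
    using dep by (metis span_base span_mul singletonI)
qed

text \<open>By Lagrange's identity the Gram determinant of two vectors in space is the squared norm
  of their cross product.\<close>

lemma det_tmb_I_pos:
  assumes "q \<in> U"
  shows "det (tmb_I \<Omega> q) > 0"
proof -
  let ?c = "cross3 (column 1 (\<Omega> q)) (column 2 (\<Omega> q))"
  have "det (tmb_I \<Omega> q) = ?c \<bullet> ?c"
    by (simp add: tmb_I_def det_2 matrix_matrix_mult_def transpose_def column_def cross3_simps)
  then show ?thesis
    using tmb_cross_nonzero[OF assms] by simp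
qed

lemma det_tmb_I_nonzero: "q \<in> U \<Longrightarrow> det (tmb_I \<Omega> q) \<noteq> 0"
  using det_tmb_I_pos by fastforce

text \<open>Tangency provides some \<open>A\<close> with \<open>Dx = \<Omega> A\<close>;
  substituting this into the definition of \<Lambda> cancels the Gram matrix and identifies
  \<Lambda> with the transpose of \<open>A\<close>.\<close>

lemma jacobian_tmb:
  assumes "q \<in> U"
  shows "jacobian x (at q) = \<Omega> q ** transpose (tmb_Lambda x \<Omega> q)"
proof -
  have cols: "columns (\<Omega> q) = {column 1 (\<Omega> q), column 2 (\<Omega> q)}"
    by (auto simp: columns_def) (metis exhaust_2)
  have "column j (jacobian x (at q)) \<in> span (columns (\<Omega> q))" for j
    using tmb assms by (auto simp: tangent_moving_basis_def columns_def)
  then have "\<exists>a b. column j (jacobian x (at q)) - a *\<^sub>R column 1 (\<Omega> q) = b *\<^sub>R column 2 (\<Omega> q)" for j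
    by (simp add: cols span_breakdown_eq span_singleton image_iff)
  then obtain a b where ab: "\<And>j. column j (jacobian x (at q)) = a j *\<^sub>R column 1 (\<Omega> q) + b j *\<^sub>R column 2 (\<Omega> q)"
    by (metis add.commute diff_add_cancel)
  define A :: "real^2^2" where "A = (\<chi> i j. if i = 1 then a j else b j)"
  have "jacobian x (at q) $ i $ j = (\<Omega> q ** A) $ i $ j" for i j
    using arg_cong[OF ab[of j], of "\<lambda>v. v $ i"]
    by (simp add: column_def matrix_matrix_mult_def A_def sum_2 mult.commute)
  then have J: "jacobian x (at q) = \<Omega> q ** A"
    by (simp add: vec_eq_iff)
  have "tmb_Lambda x \<Omega> q = transpose A ** (tmb_I \<Omega> q ** matrix_inv (tmb_I \<Omega> q))"
    by (simp add: tmb_Lambda_def J matrix_transpose_mul tmb_I_def matrix_mul_assoc)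
  then show ?thesis
    by (simp only: J matrix_mul_rid transpose_transpose matrix_inv_2(2)[OF det_tmb_I_nonzero[OF assms]])
qed

lemma fund_form_1_tmb:
  assumes "q \<in> U"
  shows "fund_form_1 x q = tmb_Lambda x \<Omega> q ** tmb_I \<Omega> q ** transpose (tmb_Lambda x \<Omega> q)"
  by (simp add: fund_form_1_def jacobian_tmb[OF assms] matrix_transpose_mul tmb_I_def matrix_mul_assoc)

text \<open>As \<open>Dx\<close> factors through \<Omega>, the form sees \<open>Dn\<close> only
  through the product of the transpose of \<Omega> with \<open>Dn\<close>, which is
  \<open>- tmb_II\<close>. Unwinding \<mu> and using the symmetry of the Gram matrix rewrites this
  as \<open>tmb_I\<close> times the transpose of \<mu>.\<close>

lemma fund_form_2_tmb:
  assumes "q \<in> U"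
  shows "fund_form_2 x \<Omega> q = - (tmb_Lambda x \<Omega> q ** tmb_I \<Omega> q ** transpose (tmb_mu \<Omega> q))"
proof -
  let ?I = "tmb_I \<Omega> q" and ?II = "tmb_II \<Omega> q"
  have neg: "(- A) ** B = - (A ** B)" "A ** (- B) = - (A ** B)" "transpose (- B) = - transpose B"
    for A :: "real^'n^'m" and B :: "real^'p^'n"
    by (simp_all add: vec_eq_iff matrix_matrix_mult_def transpose_def sum_negf)
  have "tmb_mu \<Omega> q ** ?I = - (transpose ?II ** (matrix_inv ?I ** ?I))"
    by (simp add: tmb_mu_def neg matrix_mul_assoc)
  then have "transpose (tmb_mu \<Omega> q ** ?I) = - ?II"
    by (simp only: matrix_inv_2(3)[OF det_tmb_I_nonzero[OF assms]] neg matrix_mul_rid transpose_transpose)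
  then have "?I ** transpose (tmb_mu \<Omega> q) = - ?II"
    by (simp add: matrix_transpose_mul transpose_tmb_I)
  then show ?thesis
    by (simp add: fund_form_2_def jacobian_tmb[OF assms] matrix_transpose_mul tmb_II_def neg
        flip: matrix_mul_assoc)
qed

section \<open>The unit normal and the symmetry of the second fundamental form\<close>

lemma smooth_tmb_normal: "smooth_on U (tmb_normal \<Omega>)"
  unfolding tmb_normal_def Let_def norm_eq_sqrt_inner
  using tmb_cross_nonzero
  by (intro smooth_on_scaleR smooth_on_divide smooth_on_sqrt smooth_on_inner smooth_on_cross3
      smooth_on_column smooth_on_const U tmb_smooth) auto

lemma derivative_perp_tmb_normal:
  assumes "q \<in> U"
  shows "frechet_derivative x (at q) v \<bullet> tmb_normal \<Omega> q = 0"
proof -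
  obtain y where "frechet_derivative x (at q) v = \<Omega> q *v y"
    using frechet_derivative_eq_jacobian[OF x assms] jacobian_tmb[OF assms]
    by (metis matrix_vector_mul_assoc)
  then show ?thesis
    by (simp add: matrix_mult_sum sum_2 scalar_mult_eq_scaleR tmb_normal_def Let_def inner_add_left dot_cross_self)
qed

lemma second_derivative_symmetric:
  assumes "q \<in> U"
  shows "frechet_derivative (\<lambda>r. frechet_derivative x (at r) a) (at q) b
    = frechet_derivative (\<lambda>r. frechet_derivative x (at r) b) (at q) a"
proof -
  let ?D = "\<lambda>v r. frechet_derivative x (at r) v"
  note nth = bounded_linear.has_derivative[OF bounded_linear_vec_nth]
  have D: "smooth_on U (?D v)" for v
    by (rule smooth_on_frechet_derivative[OF x])
  have "frechet_derivative (?D a) (at q) b $ i = frechet_derivative (?D b) (at q) a $ i" for i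
  proof (rule mixed_derivatives_commute[OF U assms, where f = "\<lambda>r. x r $ i" and D = "\<lambda>r v. ?D v r $ i"
        and Da = "\<lambda>r v. frechet_derivative (?D a) (at r) v $ i"
        and Db = "\<lambda>r v. frechet_derivative (?D b) (at r) v $ i"])
    show "continuous_on U (\<lambda>r. frechet_derivative (?D v) (at r) w $ i)"
      "continuous_on U (\<lambda>r. frechet_derivative (?D v) (at r) w $ i)" for v w
      by (intro smooth_on_continuous_on smooth_on_nth smooth_on_frechet_derivative D U)+
  qed (rule nth[OF smooth_on_has_derivative[OF x]] nth[OF smooth_on_has_derivative[OF D]], assumption)+
  then show ?thesis by (simp add: vec_eq_iff)
qed

text \<open>Differentiating the orthogonality of tangent derivatives and the normal moves the
  derivative from the normal to \<open>x\<close>; what remains is the normal component of a second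
  derivative of \<open>x\<close>, which is symmetric.\<close>

lemma fund_form_2_symmetric:
  assumes "q \<in> U"
  shows "fund_form_2 x \<Omega> q $ 1 $ 2 = fund_form_2 x \<Omega> q $ 2 $ 1"
proof -
  let ?n = "tmb_normal \<Omega>" and ?D = "\<lambda>v r. frechet_derivative x (at r) v"
  have perp: "?D a q \<bullet> frechet_derivative ?n (at q) b = - (frechet_derivative (?D a) (at q) b \<bullet> ?n q)" for a b
  proof -
    have "((\<lambda>r. ?D a r \<bullet> ?n r) has_derivative
        (\<lambda>v. ?D a q \<bullet> frechet_derivative ?n (at q) v + frechet_derivative (?D a) (at q) v \<bullet> ?n q)) (at q)"
      by (intro has_derivative_inner smooth_on_has_derivative[OF _ assms] smooth_on_frechet_derivative[OF x]
          smooth_tmb_normal)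
    moreover have "((\<lambda>r. ?D a r \<bullet> ?n r) has_derivative (\<lambda>v. 0)) (at q)"
      by (rule has_derivative_transform_within_open[OF has_derivative_const[of 0] U assms])
        (simp add: derivative_perp_tmb_normal)
    ultimately show ?thesis
      using has_derivative_unique by (fastforce dest: fun_cong[of _ _ b])
  qed
  have "fund_form_2 x \<Omega> q $ i $ j = frechet_derivative (?D (axis i 1)) (at q) (axis j 1) \<bullet> ?n q" for i j
  proof -
    have "fund_form_2 x \<Omega> q $ i $ j = - (?D (axis i 1) q \<bullet> frechet_derivative ?n (at q) (axis j 1))"
      by (simp add: fund_form_2_def matrix_matrix_mult_def transpose_def inner_vec_def jacobian_def matrix_def)
    then show ?thesis by (simp add: perp)
  qed
  then show ?thesis
    using second_derivative_symmetric[OF assms] by simp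
qed

section \<open>Smoothness of the associated functions and the curvature formulas\<close>

lemma smooth_tmb_functions:
  shows "smooth_on U (\<lambda>q. det (tmb_I \<Omega> q))" "smooth_on U (tmb_lambda x \<Omega>)"
    "smooth_on U (tmb_K \<Omega>)" "smooth_on U (tmb_H x \<Omega>)"
proof -
  have I: "smooth_on U (tmb_I \<Omega>)"
    unfolding tmb_I_def by (intro smooth_on_matrix_mult smooth_on_transpose tmb_smooth U)
  then show "smooth_on U (\<lambda>q. det (tmb_I \<Omega> q))"
    by (rule smooth_on_det_2[OF U])
  have inv: "smooth_on U (\<lambda>q. matrix_inv (tmb_I \<Omega> q))"
    by (intro smooth_on_matrix_inv_2 det_tmb_I_nonzero U I)
  have mu: "smooth_on U (tmb_mu \<Omega>)"
    unfolding tmb_mu_def tmb_II_def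
    by (intro smooth_on_minus smooth_on_matrix_mult smooth_on_transpose smooth_on_jacobian
        smooth_tmb_normal tmb_smooth inv U)
  have Lambda: "smooth_on U (tmb_Lambda x \<Omega>)"
    unfolding tmb_Lambda_def
    by (intro smooth_on_matrix_mult smooth_on_transpose smooth_on_jacobian x tmb_smooth inv U)
  show "smooth_on U (tmb_lambda x \<Omega>)"
    unfolding tmb_lambda_def by (intro smooth_on_det_2 Lambda U)
  show "smooth_on U (tmb_K \<Omega>)"
    unfolding tmb_K_def by (intro smooth_on_det_2 mu U)
  show "smooth_on U (tmb_H x \<Omega>)"
    unfolding tmb_H_def
    by (intro smooth_on_mult smooth_on_const smooth_on_trace smooth_on_matrix_mult smooth_on_adj2 mu Lambda U)
qed

lemma curvature_identities:
  assumes "q \<in> U"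
  shows "coeff_E x q * coeff_G x q - (coeff_F x q)\<^sup>2 = (tmb_lambda x \<Omega> q)\<^sup>2 * det (tmb_I \<Omega> q)"
    and "coeff_e x \<Omega> q * coeff_g x \<Omega> q - (coeff_f x \<Omega> q)\<^sup>2
      = tmb_lambda x \<Omega> q * tmb_K \<Omega> q * det (tmb_I \<Omega> q)"
    and "coeff_e x \<Omega> q * coeff_G x q + coeff_g x \<Omega> q * coeff_E x q - 2 * coeff_f x \<Omega> q * coeff_F x q
      = 2 * tmb_lambda x \<Omega> q * det (tmb_I \<Omega> q) * tmb_H x \<Omega> q"
  using fundamental_forms_via_basis[OF transpose_tmb_I[of \<Omega> q], of "tmb_Lambda x \<Omega> q" "tmb_mu \<Omega> q"]
    fund_form_2_symmetric[OF assms]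
  by (simp_all add: coeff_E_def coeff_F_def coeff_G_def coeff_e_def coeff_f_def coeff_g_def
      tmb_lambda_def tmb_K_def tmb_H_def fund_form_1_tmb[OF assms] fund_form_2_tmb[OF assms])

text \<open>A nonzero kernel vector of the transpose of \<Lambda> would be killed by
  \<open>Dx\<close> as well, against injectivity off the singular set.\<close>

lemma tmb_lambda_nonzero:
  assumes "q \<in> U" "q \<notin> singular_set U x"
  shows "tmb_lambda x \<Omega> q \<noteq> 0"
proof
  assume "tmb_lambda x \<Omega> q = 0"
  then have "\<not> invertible (transpose (tmb_Lambda x \<Omega> q))"
    by (simp add: tmb_lambda_def invertible_det_nz det_transpose)
  then obtain v where v: "v \<noteq> 0" "transpose (tmb_Lambda x \<Omega> q) *v v = 0"
    using matrix_left_invertible_ker invertible_left_inverse by blast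
  have "frechet_derivative x (at q) v = \<Omega> q *v (transpose (tmb_Lambda x \<Omega> q) *v v)"
    by (simp only: frechet_derivative_eq_jacobian[OF x assms(1)] jacobian_tmb[OF assms(1)] matrix_vector_mul_assoc)
  with v have "frechet_derivative x (at q) v = frechet_derivative x (at q) 0"
    by (simp add: frechet_derivative_eq_jacobian[OF x assms(1)])
  moreover have "inj (frechet_derivative x (at q))"
    using assms by (simp add: singular_set_def immersive_at_def)
  ultimately show False
    using v(1) by (auto dest: injD)
qed

lemma curvatures_tmb:
  assumes "q \<in> U" "q \<notin> singular_set U x"
  shows "mean_curv x \<Omega> q = tmb_H x \<Omega> q / tmb_lambda x \<Omega> q"
    and "gauss_curv x \<Omega> q = tmb_K \<Omega> q / tmb_lambda x \<Omega> q"
    and "tmb_lambda x \<Omega> q * tmb_K \<Omega> q \<le> (tmb_H x \<Omega> q)\<^sup>2"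
proof -
  note nz = tmb_lambda_nonzero[OF assms] and pos = det_tmb_I_pos[OF assms(1)]
    and ids = curvature_identities[OF assms(1)]
  show "mean_curv x \<Omega> q = tmb_H x \<Omega> q / tmb_lambda x \<Omega> q"
    unfolding mean_curv_def ids using nz pos by (simp add: field_simps power2_eq_square)
  show "gauss_curv x \<Omega> q = tmb_K \<Omega> q / tmb_lambda x \<Omega> q"
    unfolding gauss_curv_def ids using nz pos by (simp add: field_simps power2_eq_square)
  have P: "coeff_E x q * coeff_G x q - (coeff_F x q)\<^sup>2 > 0"
    using nz pos by (simp add: ids)
  \<comment> \<open>\<open>E\<close> is a sum of squares, and \<open>E = 0\<close> would make
    \<open>E * G - F\<^sup>2\<close> nonpositive; so the first form is positive definite, as the
    discriminant inequality requires.\<close>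
  have "coeff_E x q \<ge> 0"
    by (simp add: coeff_E_def fund_form_1_def matrix_matrix_mult_def transpose_def sum_nonneg)
  moreover have "coeff_E x q \<noteq> 0"
    using P by (auto simp: not_less)
  ultimately have "4 * ((tmb_lambda x \<Omega> q)\<^sup>2 * det (tmb_I \<Omega> q))
      * (tmb_lambda x \<Omega> q * tmb_K \<Omega> q * det (tmb_I \<Omega> q))
    \<le> (2 * tmb_lambda x \<Omega> q * det (tmb_I \<Omega> q) * tmb_H x \<Omega> q)\<^sup>2"
    using binary_forms_discriminant[OF _ P, of "coeff_e x \<Omega> q" "coeff_g x \<Omega> q" "coeff_f x \<Omega> q"]
    unfolding ids by simp
  \<comment> \<open>Both sides share the square of \<open>2 \<lambda> d\<close>, with
    \<open>d\<close> the Gram determinant; it is positive off the singular set and can be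
    cancelled.\<close>
  then have "(2 * tmb_lambda x \<Omega> q * det (tmb_I \<Omega> q))\<^sup>2 * (tmb_lambda x \<Omega> q * tmb_K \<Omega> q)
    \<le> (2 * tmb_lambda x \<Omega> q * det (tmb_I \<Omega> q))\<^sup>2 * (tmb_H x \<Omega> q)\<^sup>2"
    by (simp add: power2_eq_square algebra_simps)
  moreover have "(2 * tmb_lambda x \<Omega> q * det (tmb_I \<Omega> q))\<^sup>2 > 0"
    using nz pos by simp
  ultimately show "tmb_lambda x \<Omega> q * tmb_K \<Omega> q \<le> (tmb_H x \<Omega> q)\<^sup>2"
    by (rule mult_left_le_imp_le)
qed

end

section \<open>Extension across the singular set\<close>

text \<open>The denominators are the roots of \<open>t\<^sup>2 - 2 a t + b\<close>, with sum
  \<open>2 a\<close> and product \<open>b\<close>; a nonzero product keeps both away from 0. It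
  serves both the principal and the relative principal curvatures.\<close>

lemma sum_inverse_roots:
  fixes a b :: real
  assumes "b \<le> a\<^sup>2" "b \<noteq> 0"
  shows "1 / (a - sqrt (a\<^sup>2 - b)) + 1 / (a + sqrt (a\<^sup>2 - b)) = 2 * a / b"
proof -
  let ?r = "sqrt (a\<^sup>2 - b)"
  have prod: "(a - ?r) * (a + ?r) = b"
    using assms(1) by (simp add: algebra_simps flip: power2_eq_square)
  then have "a - ?r \<noteq> 0" "a + ?r \<noteq> 0"
    using assms(2) by auto
  then have "1 / (a - ?r) + 1 / (a + ?r) = 2 * a / ((a - ?r) * (a + ?r))"
    by (simp add: divide_simps)
  then show ?thesis by (simp only: prod)
qed

text \<open>The points of \<open>V\<close> where \<open>f\<close> and \<open>g\<close> differ form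
  an open subset of \<open>S\<close>, which must be empty.\<close>

lemma continuous_on_eq_off_empty_interior:
  fixes f g :: "'a::topological_space \<Rightarrow> real"
  assumes "open V" "continuous_on V f" "continuous_on V g" "interior S = {}"
    and eq: "\<And>q. q \<in> V - S \<Longrightarrow> f q = g q" and "q \<in> V"
  shows "f q = g q"
proof (rule ccontr)
  let ?D = "(\<lambda>q. f q - g q) -` (- {0}) \<inter> V"
  assume "f q \<noteq> g q"
  then have "q \<in> ?D" using \<open>q \<in> V\<close> by simp
  moreover have "open ?D"
    using assms(1-3) by (intro continuous_on_open_vimage[THEN iffD1, rule_format] continuous_intros) auto
  moreover have "?D \<subseteq> S" using eq by auto
  ultimately show False using assms(4) interior_maximal by blast
qed

theorem proposition5p4:
  fixes U V :: "(real^2) set"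
    and x :: "real^2 \<Rightarrow> real^3"
    and \<Omega> :: "real^2 \<Rightarrow> real^2^3"
    and p :: "real^2"
  assumes "open U"
    and "wavefront U x"
    and "proper_on U x"
    and "tangent_moving_basis U x \<Omega>"
    and "p \<in> singular_set U x"
    and "rank (jacobian x (at p)) = 0"
    and "open V" and "p \<in> V" and "V \<subseteq> U"
    and "\<forall>q\<in>V. tmb_K \<Omega> q \<noteq> 0"
  defines "S1 \<equiv> has_smooth_extension V (singular_set U x) (mean_curv x \<Omega>)"
    and "S2 \<equiv> tmb_H x \<Omega> \<in> tmb_ideal x \<Omega> V"
    and "S3 \<equiv> (\<lambda>q. coeff_e x \<Omega> q * coeff_G x q + coeff_g x \<Omega> q * coeff_E x q
                 - 2 * coeff_f x \<Omega> q * coeff_F x q) \<in> tmb_ideal_sq x \<Omega> V"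
    and "S4 \<equiv> \<exists>\<phi>. is_smooth_extension V (singular_set U x)
                 (\<lambda>q. 1 / princ_k1 x \<Omega> q + 1 / princ_k2 x \<Omega> q) \<phi> \<and> \<phi> \<in> tmb_ideal x \<Omega> V"
    and "S5 \<equiv> has_smooth_extension V (singular_set U x)
                 (\<lambda>q. 1 / rel_k1 x \<Omega> q + 1 / rel_k2 x \<Omega> q)"
  shows "(S1 \<longleftrightarrow> S2) \<and> (S2 \<longleftrightarrow> S3) \<and> (S3 \<longleftrightarrow> S4) \<and> (S4 \<longleftrightarrow> S5)"
proof -
  let ?\<Sigma> = "singular_set U x" and ?l = "tmb_lambda x \<Omega>" and ?H = "tmb_H x \<Omega>" and ?K = "tmb_K \<Omega>"
    and ?d = "\<lambda>q. det (tmb_I \<Omega> q)"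
    and ?N = "\<lambda>q. coeff_e x \<Omega> q * coeff_G x q + coeff_g x \<Omega> q * coeff_E x q
                 - 2 * coeff_f x \<Omega> q * coeff_F x q"
  have "smooth_on U x"
    using assms(2) by (simp add: wavefront_def)
  note ctx = \<open>open U\<close> this \<open>tangent_moving_basis U x \<Omega>\<close>
  have sm: "smooth_on V ?d" "smooth_on V ?l" "smooth_on V ?K" "smooth_on V ?H"
    using smooth_tmb_functions[OF ctx] \<open>V \<subseteq> U\<close> by (blast intro: smooth_on_subset)+
  note smI = sm smooth_on_mult smooth_on_const smooth_on_divide \<open>open V\<close>
  have d: "?d q > 0" if "q \<in> V" for q
    using det_tmb_I_pos[OF ctx] that \<open>V \<subseteq> U\<close> by blast
  have K: "?K q \<noteq> 0" if "q \<in> V" for q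
    using assms(10) that by blast
  have N: "?N q = 2 * ?l q * ?d q * ?H q" if "q \<in> V" for q
    using curvature_identities(3)[OF ctx] that \<open>V \<subseteq> U\<close> by blast
  have reg: "q \<in> U" "q \<notin> ?\<Sigma>" if "q \<in> V - ?\<Sigma>" for q
    using that \<open>V \<subseteq> U\<close> by auto
  note l = tmb_lambda_nonzero[OF ctx reg] and curv = curvatures_tmb[OF ctx reg]
  \<comment> \<open>Properness enters here: smooth identities on \<open>V\<close> need checking only
    off the singular set.\<close>
  have dense: "f q = g q"
    if "smooth_on V f" "smooth_on V g" "\<And>q. q \<in> V - ?\<Sigma> \<Longrightarrow> f q = g q" "q \<in> V" for f g :: "real^2 \<Rightarrow> real" and q
    using continuous_on_eq_off_empty_interior[of V f g ?\<Sigma> q] that assms(3,7)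
    by (simp add: smooth_on_continuous_on proper_on_def)
  have k: "1 / princ_k1 x \<Omega> q + 1 / princ_k2 x \<Omega> q = 2 * ?H q / ?K q" if q: "q \<in> V - ?\<Sigma>" for q
  proof -
    have "gauss_curv x \<Omega> q \<le> (mean_curv x \<Omega> q)\<^sup>2"
      using divide_right_mono[OF curv(3)[OF q q], of "(?l q)\<^sup>2"] l[OF q q]
      by (simp add: curv(1,2)[OF q q] power_divide power2_eq_square)
    \<comment> \<open>The sign of \<lambda> only decides which root is called \<open>k1\<close>, so
      both branches give the same sum of reciprocals.\<close>
    then have "1 / princ_k1 x \<Omega> q + 1 / princ_k2 x \<Omega> q = 2 * mean_curv x \<Omega> q / gauss_curv x \<Omega> q"
      using sum_inverse_roots[of "gauss_curv x \<Omega> q" "mean_curv x \<Omega> q"] curv(2)[OF q q] K l[OF q q] q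
      by (auto simp: princ_k1_def princ_k2_def add.commute)
    then show ?thesis
      using l[OF q q] by (simp add: curv(1,2)[OF q q])
  qed
  have rel: "1 / rel_k1 x \<Omega> q + 1 / rel_k2 x \<Omega> q = 2 * ?H q / (?l q * ?K q)" if q: "q \<in> V - ?\<Sigma>" for q
    unfolding rel_k1_def rel_k2_def
    using curv(3)[OF q q] l[OF q q] K q by (intro sum_inverse_roots) auto
  \<comment> \<open>In this form one may divide by \<lambda> when producing the cofactor
    \<open>h\<close>, since the relation is tested only where \<lambda> is nonzero.\<close>
  have S2_iff: "S2 \<longleftrightarrow> (\<exists>h. smooth_on V h \<and> (\<forall>q\<in>V - ?\<Sigma>. ?H q = h q * ?l q))"
    (is "_ \<longleftrightarrow> ?R")
  proof
    assume ?R
    then obtain h where h: "smooth_on V h" "\<And>q. q \<in> V - ?\<Sigma> \<Longrightarrow> ?H q = h q * ?l q" by blast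
    have "?H q = h q * ?l q" if "q \<in> V" for q
      by (rule dense[OF _ _ h(2) that]) (intro smI h)+
    then show S2 using h(1) sm by (auto simp: S2_def smooth_principal_ideal_def)
  qed (auto simp: S2_def smooth_principal_ideal_def)
  \<comment> \<open>Off the singular set \<open>H\<close> is \<open>?H / ?l\<close>, so the smooth
    extensions of \<open>H\<close> are exactly the cofactors \<open>h\<close> in
    \<open>S2_iff\<close>.\<close>
  have "S1 \<longleftrightarrow> S2"
    unfolding S2_iff S1_def has_smooth_extension_def is_smooth_extension_def
    using l by (intro ex_cong1 conj_cong ball_cong refl) (simp add: curv eq_divide_eq, metis)
  moreover have "S2 \<longleftrightarrow> S3"
  proof
    assume S2
    then obtain h where h: "smooth_on V h" "\<And>q. q \<in> V \<Longrightarrow> ?H q = h q * ?l q"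
      by (auto simp: S2_def smooth_principal_ideal_def)
    have "smooth_on V ?N"
      by (rule smooth_on_cong[OF \<open>open V\<close>, of "\<lambda>q. 2 * ?l q * ?d q * ?H q"]) (simp add: N, intro smI)
    moreover have "smooth_on V (\<lambda>q. 2 * ?d q * h q)"
      by (intro smI h)
    \<comment> \<open>One factor \<lambda> is already present in the formula for \<open>?N\<close>;
      the other comes from \<open>?H = h \<lambda>\<close>.\<close>
    moreover have "?N q = 2 * ?d q * h q * (?l q)\<^sup>2" if "q \<in> V" for q
      using that by (simp add: N h(2) power2_eq_square)
    ultimately show S3
      unfolding S3_def smooth_principal_ideal_def by blast
  next
    assume S3
    then obtain h where h: "smooth_on V h" "\<And>q. q \<in> V \<Longrightarrow> ?N q = h q * (?l q)\<^sup>2"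
      unfolding S3_def smooth_principal_ideal_def by blast
    \<comment> \<open>This cofactor results from cancelling one \<lambda> in
      \<open>2 \<lambda> d ?H = h \<lambda>\<^sup>2\<close>.\<close>
    have "smooth_on V (\<lambda>q. h q / (2 * ?d q))"
      using d by (intro smI h) force
    moreover have "?H q = h q / (2 * ?d q) * ?l q" if "q \<in> V - ?\<Sigma>" for q
      using h(2)[of q] N[of q] that l[OF that that] d[of q]
      by (simp add: field_simps power2_eq_square)
    ultimately show S2
      unfolding S2_iff by blast
  qed
  moreover have "S2 \<longleftrightarrow> S4"
  proof
    assume S2
    then obtain h where h: "smooth_on V h" "\<And>q. q \<in> V \<Longrightarrow> ?H q = h q * ?l q"
      by (auto simp: S2_def smooth_principal_ideal_def)
    \<comment> \<open>By \<open>k\<close> this is the sum of reciprocals off the singular set, and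
      it is smooth on all of \<open>V\<close> because \<open>?K\<close> has no zero there.\<close>
    let ?\<phi> = "\<lambda>q. 2 * ?H q / ?K q"
    have "smooth_on V ?\<phi>" "smooth_on V (\<lambda>q. 2 * h q / ?K q)"
      using K by (intro smI h; simp)+
    moreover have "?\<phi> q = 2 * h q / ?K q * ?l q" if "q \<in> V" for q
      using h(2)[OF that] by simp
    ultimately have "is_smooth_extension V ?\<Sigma> (\<lambda>q. 1 / princ_k1 x \<Omega> q + 1 / princ_k2 x \<Omega> q) ?\<phi>"
      "?\<phi> \<in> tmb_ideal x \<Omega> V"
      using k by (auto simp: is_smooth_extension_def smooth_principal_ideal_def)
    then show S4 unfolding S4_def by blast
  next
    assume S4
    then obtain \<phi> h where \<phi>: "smooth_on V h" "\<And>q. q \<in> V \<Longrightarrow> \<phi> q = h q * ?l q"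
      "\<And>q. q \<in> V - ?\<Sigma> \<Longrightarrow> \<phi> q = 1 / princ_k1 x \<Omega> q + 1 / princ_k2 x \<Omega> q"
      unfolding S4_def is_smooth_extension_def smooth_principal_ideal_def by blast
    have "smooth_on V (\<lambda>q. h q * ?K q / 2)"
      by (intro smI \<phi>) simp
    moreover have "?H q = h q * ?K q / 2 * ?l q" if "q \<in> V - ?\<Sigma>" for q
      using \<phi>(3)[OF that] k[OF that] \<phi>(2)[of q] K[of q] that by (simp add: field_simps)
    ultimately show S2
      unfolding S2_iff by blast
  qed
  moreover have "S2 \<longleftrightarrow> S5"
  proof
    assume S2
    then obtain h where h: "smooth_on V h" "\<And>q. q \<in> V - ?\<Sigma> \<Longrightarrow> ?H q = h q * ?l q"
      unfolding S2_iff by blast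
    \<comment> \<open>In \<open>rel\<close> the \<lambda> of the denominator cancels against the one
      in \<open>?H = h \<lambda>\<close>; the converse solves the same relation for
      \<open>?H\<close>.\<close>
    have "smooth_on V (\<lambda>q. 2 * h q / ?K q)"
      using K by (intro smI h)
    moreover have "2 * h q / ?K q = 1 / rel_k1 x \<Omega> q + 1 / rel_k2 x \<Omega> q" if "q \<in> V - ?\<Sigma>" for q
      using h(2)[OF that] l[OF that that] by (simp add: rel[OF that])
    ultimately show S5
      unfolding S5_def has_smooth_extension_def is_smooth_extension_def by blast
  next
    assume S5
    then obtain g where g: "smooth_on V g" "\<And>q. q \<in> V - ?\<Sigma> \<Longrightarrow> g q = 2 * ?H q / (?l q * ?K q)"
      using rel by (auto simp: S5_def has_smooth_extension_def is_smooth_extension_def)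
    have "smooth_on V (\<lambda>q. g q * ?K q / 2)"
      by (intro smI g) simp
    moreover have "?H q = g q * ?K q / 2 * ?l q" if "q \<in> V - ?\<Sigma>" for q
      using g(2)[OF that] l[OF that that] K[of q] that by simp
    ultimately show S2
      unfolding S2_iff by blast
  qed
  ultimately show ?thesis by blast
qed

end
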